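(* Let $m$ be the mode of a categorical feature $\mathsf{F}$, let $u^{\prime}\in\mathrm{dom}(\mathsf{F})$ be an outlying value and $v^{\prime}\in\mathrm{dom}(\mathsf{F})$ a normal value, so that $\mathrm{freq}(u^{\prime})<\mathrm{freq}(v^{\prime})$. Then $$\delta(u^{\prime})-\delta(v^{\prime})>\phi_{\mathrm{freq}}(u^{\prime})-\phi_{\mathrm{freq}}(v^{\prime}).$$
   Context: A finite set of $N$ data objects is described by categorical features; $\mathsf{F}$ is one of them, with finite domain $\mathrm{dom}(\mathsf{F})$. For $v\in\mathrm{dom}(\mathsf{F})$, $\mathrm{supp}(v)$ is the number of data objects taking value $v$ in feature $\mathsf{F}$, and $\mathrm{freq}(v)=\mathrm{supp}(v)/N$. The mode $m$ of $\mathsf{F}$ is a value in $\mathrm{dom}(\mathsf{F})$ of maximal frequency; features with $\mathrm{freq}(m)=1$ are discarded, so $0<\mathrm{freq}(m)<1$. The mode-based outlierness of $v\in\mathrm{dom}(\mathsf{F})$ is $$\delta(v)=\bigl(1-\mathrm{freq}(m)\bigr)+\frac{\mathrm{freq}(m)-\mathrm{freq}(v)}{\mathrm{freq}(m)},$$ and the baseline frequency-based outlierness is $\phi_{\mathrm{freq}}(v)=1-\mathrm{freq}(v)$. Outlying values are infrequent values (contained by outliers) and normal values are frequent values (contained by normal objects); for the purpose of this statement this means that an outlying value has strictly smaller frequency than a normal value of the same feature. *)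

theory Defs
  imports Complex_Main "HOL-Library.FuncSet"
begin

(* A categorical feature of a finite set X of data objects is the map F sending
   each object to the value it takes; its domain is a finite set V of values, which
   may contain values taken by no object. *)

definition supp :: "'a set \<Rightarrow> ('a \<Rightarrow> 'b) \<Rightarrow> 'b \<Rightarrow> nat" where
  "supp X F v = card {x \<in> X. F x = v}"

definition freq :: "'a set \<Rightarrow> ('a \<Rightarrow> 'b) \<Rightarrow> 'b \<Rightarrow> real" where
  "freq X F v = real (supp X F v) / real (card X)"

definition is_mode :: "'a set \<Rightarrow> 'b set \<Rightarrow> ('a \<Rightarrow> 'b) \<Rightarrow> 'b \<Rightarrow> bool" where
  "is_mode X V F m \<longleftrightarrow> m \<in> V \<and> (\<forall>v\<in>V. freq X F v \<le> freq X F m)"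

(* The mode need not be unique, so the chosen one is passed as the argument m;
   the value depends on m only through its frequency, which is the same for all modes. *)
definition mode_outlierness :: "'a set \<Rightarrow> ('a \<Rightarrow> 'b) \<Rightarrow> 'b \<Rightarrow> 'b \<Rightarrow> real" where
  "mode_outlierness X F m v =
     (1 - freq X F m) + (freq X F m - freq X F v) / freq X F m"

definition freq_outlierness :: "'a set \<Rightarrow> ('a \<Rightarrow> 'b) \<Rightarrow> 'b \<Rightarrow> real" where
  "freq_outlierness X F v = 1 - freq X F v"

end

theory Submission
  imports Defs
begin

text \<open>Both outlierness measures depend affinely on the frequency, with slope \<open>-1\<close> for the
  baseline and slope \<open>-1 / freq m\<close> for the mode-based one; the latter is steeper because
  \<open>0 < freq m < 1\<close>.\<close>

lemma freq_nonneg: "0 \<le> freq X F v"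
  by (simp add: freq_def)

lemma freq_le_1:
  assumes "finite X"
  shows "freq X F v \<le> 1"
proof -
  have "supp X F v \<le> card X"
    unfolding supp_def using assms by (intro card_mono) auto
  \<comment> \<open>For empty \<open>X\<close> the bound rests on division by zero yielding
    0.\<close>
  then show ?thesis
    by (auto simp: freq_def divide_le_eq_1)
qed

theorem theorem3:
  fixes X :: "'a set" and V :: "'b set" and F :: "'a \<Rightarrow> 'b" and m u v :: 'b
  assumes "finite X" and "X \<noteq> {}"
    and "finite V" and "F \<in> X \<rightarrow> V"
    and "is_mode X V F m" and "freq X F m \<noteq> 1"
    and "u \<in> V" and "v \<in> V"
    and "freq X F u < freq X F v"
  shows "mode_outlierness X F m u - mode_outlierness X F m v
           > freq_outlierness X F u - freq_outlierness X F v"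
proof -
  have "freq X F v \<le> freq X F m"
    using assms(5,8) by (simp add: is_mode_def)
  \<comment> \<open>Strictness comes from the gap between the two values: 0 \<le>
    \<open>freq X F u\<close> < \<open>freq X F v\<close> \<le> \<open>freq X F m\<close>.\<close>
  then have pos: "0 < freq X F m"
    using assms(9) freq_nonneg[of X F u] by linarith
  have "freq X F m < 1"
    using freq_le_1[OF assms(1), of F m] assms(6) by linarith
  \<comment> \<open>Dividing a positive gap by a number strictly between 0 and 1 enlarges
    it.\<close>
  then have "freq X F v - freq X F u < (freq X F v - freq X F u) / freq X F m"
    using pos assms(9) by (simp add: pos_less_divide_eq)
  \<comment> \<open>In both differences the terms independent of the value cancel, leaving exactly
    the two sides just compared.\<close>
  then show ?thesis
    by (simp add: mode_outlierness_def freq_outlierness_def diff_divide_distrib)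
qed

end
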